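(* Let $(X,M,\ast)$ be a fuzzy metric space in the sense of Kramosil and Michálek and let $T:X\to X$ be a Mihe\c{t} fuzzy $\psi$-contraction, with associated function $\psi\in\Psi$. Define $\theta_{\psi}:[0,1]\times[0,1]\to\mathbb{R}$ by $\theta_{\psi}(t,s)=t-\psi(s)$ for all $t,s\in[0,1]$. Then $T$ is a type-2 fuzzy ample spectrum contraction w.r.t. $(M,\mathcal{S}_X,\theta_{\psi})$, where $\mathcal{S}_X=X\times X$ is the trivial binary relation on $X$. Moreover, properties $(\widetilde{\mathcal{F}}_2')$ and $(\widetilde{\mathcal{F}}_5)$ hold for $(M,\mathcal{S}_X,\theta_\psi)$; if $t,s\in[0,1]$ satisfy $\theta_{\psi}(t,s)\ge0$ and $s>0$, then $t>0$; and $\theta_{\psi}(t,s)\le t-s$ for all $t,s\in[0,1]$.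
   Context: Notation: $\mathbb{I}=[0,1]$. A t-norm is a function $\ast:\mathbb{I}\times\mathbb{I}\to\mathbb{I}$ that is associative, commutative, nondecreasing in each argument and has $1$ as unity. A fuzzy metric space in the sense of Kramosil and Michálek (KM-FMS) is a triple $(X,M,\ast)$ with $X$ non-empty, $\ast$ a t-norm and $M:X\times X\times[0,\infty)\to\mathbb{I}$ such that for all $x,y,z\in X$, $t,s\ge0$: (1) $M(x,y,0)=0$; (2) $M(x,y,t)=1$ for all $t>0$ iff $x=y$; (3) $M(x,y,t)=M(y,x,t)$; (4) $M(x,z,t+s)\ge M(x,y,t)\ast M(y,z,s)$; (5) $M(x,y,\cdot)$ is left-continuous on $[0,\infty)$. $\Psi$ is the family of all continuous and nondecreasing functions $\psi:\mathbb{I}\to\mathbb{I}$ with $\psi(t)>t$ for all $t\in(0,1)$. Given a KM-FMS $(X,M,\ast)$ (with $\ast$ assumed continuous in this definition), $T:X\to X$ is a (Mihe\c{t}) fuzzy $\psi$-contraction if there is $\psi\in\Psi$ such that for all $x,y\in X$ and $t>0$: $M(x,y,t)>0$ implies $M(Tx,Ty,t)\ge\psi(M(x,y,t))$. For a binary relation $\mathcal{S}\subseteq X\times X$, $x\mathcal{S}^{\ast}y$ means $(x,y)\in\mathcal{S}$ and $x\ne y$ (so $x\mathcal{S}_X^{\ast}y$ means just $x\neq y$). A sequence is $\mathcal{S}$-strictly-increasing if $x_n\mathcal{S}^{\ast}x_{n+1}$ for all $n$. A Picard sequence of $T$ is one with $x_{n+1}=Tx_n$ for all $n$. Let $B\subseteq\mathbb{R}^2$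 and $\theta:B\to\mathbb{R}$ (here $B=\mathbb{I}\times\mathbb{I}$, $\theta=\theta_\psi$). Put $\mathcal{M}_T=\{(M(Tx,Ty,t),M(x,y,t)):x,y\in X,\ x\mathcal{S}^{\ast}y,\ Tx\mathcal{S}^{\ast}Ty,\ t\in[0,\infty)\}$. A sequence $\{(\phi_n,\psi_n)\}$ of pairs of functions $[0,\infty)\to\mathbb{I}$ is a $(T,\mathcal{S}^{\ast},M)$-sequence if there are $\{x_n\},\{y_n\}\subseteq X$ with $x_n\mathcal{S}^{\ast}y_n$, $Tx_n\mathcal{S}^{\ast}Ty_n$, $\phi_n(t)=M(Tx_n,Ty_n,t)$, $\psi_n(t)=M(x_n,y_n,t)$ for all $n$ and all $t>0$. $T$ is a type-2 fuzzy ample spectrum contraction w.r.t. $(M,\mathcal{S},\theta)$ if: $(\mathcal{F}_1)$ $B$ is nonempty and $\mathcal{M}_T\subseteq B$. $(\widetilde{\mathcal{F}}_2)$ If $\{x_n\}$ is a Picard $\mathcal{S}$-strictly-increasing sequence of $T$ such that $M(x_n,x_{n+1},t)>0$ and $\theta(M(x_{n+1},x_{n+2},t),M(x_n,x_{n+1},t))\ge0$ for all $n$ and all $t>0$, then $\lim_nM(x_n,x_{n+1},t)=1$ for all $t>0$. $(\mathcal{F}_3)$ If $\{(\phi_n,\psi_n)\}$ is a $(T,\mathcal{S}^{\ast},M)$-sequence and $t_0>0$ are such that $\{\phi_n(t_0)\}$ and $\{\psi_n(t_0)\}$ converge to the same limit $L\in\mathbb{I}$, with $L>\phi_n(t_0)$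 and $\theta(\phi_n(t_0),\psi_n(t_0))\ge0$ for all $n$, then $L=1$. $(\widetilde{\mathcal{F}}_4)$ If $x,y\in X$ are such that $x\mathcal{S}^{\ast}y$ and $Tx\mathcal{S}^{\ast}Ty$, and $t_0>0$ is such that $M(x,y,t_0)>0$, then $\theta(M(Tx,Ty,t_0),M(x,y,t_0))\ge0$. Additional properties: $(\widetilde{\mathcal{F}}_2')$ If $\{x_n\},\{y_n\}$ are two Picard sequences of $T$ such that $x_n\mathcal{S}^{\ast}y_n$, $M(x_n,y_n,t)>0$ and $\theta(M(x_{n+1},y_{n+1},t),M(x_n,y_n,t))\ge0$ for all $n$ and all $t>0$, then $\lim_nM(x_n,y_n,t)=1$ for all $t>0$. $(\widetilde{\mathcal{F}}_5)$ If $\{(\phi_n,\psi_n)\}$ is a $(T,\mathcal{S}^{\ast},M)$-sequence such that $\phi_n(t)>0$, $\psi_n(t)>0$ and $\theta(\phi_n(t),\psi_n(t))\ge0$ for all $n$ and all $t>0$, and $\psi_n(t)\to1$ for all $t>0$, then $\phi_n(t)\to1$ for all $t>0$. *)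

theory Defs
  imports "HOL-Analysis.Analysis"
begin

text \<open>
  Functions on the interval \<open>[0, 1]\<close>, on \<open>[0, \<infinity>)\<close> or on a carrier set \<open>X\<close> are represented by
  total functions; they are constrained only on their intended domain.
\<close>

abbreviation unit_interval :: "real set" (\<open>\<I>\<close>)
  where "\<I> \<equiv> {0..1}"

locale t_norm =
  fixes star :: "real \<Rightarrow> real \<Rightarrow> real"
  assumes star_closed: "\<lbrakk>a \<in> \<I>; b \<in> \<I>\<rbrakk> \<Longrightarrow> star a b \<in> \<I>"
    and star_assoc: "\<lbrakk>a \<in> \<I>; b \<in> \<I>; c \<in> \<I>\<rbrakk> \<Longrightarrow> star (star a b) c = star a (star b c)"
    and star_commute: "\<lbrakk>a \<in> \<I>; b \<in> \<I>\<rbrakk> \<Longrightarrow> star a b = star b a"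
    and star_mono: "\<lbrakk>a \<in> \<I>; b \<in> \<I>; c \<in> \<I>; d \<in> \<I>; a \<le> c; b \<le> d\<rbrakk> \<Longrightarrow> star a b \<le> star c d"
    and star_one: "a \<in> \<I> \<Longrightarrow> star a 1 = a"

text \<open>
  Left-continuity on \<open>[0, \<infinity>)\<close> carries no condition at \<open>0\<close>, since the domain
  contains no points to the left of \<open>0\<close>.
\<close>

locale km_fuzzy_metric_space = t_norm star
  for X :: "'a set" and M :: "'a \<Rightarrow> 'a \<Rightarrow> real \<Rightarrow> real" and star +
  assumes carrier_nonempty: "X \<noteq> {}"
    and M_closed: "\<lbrakk>x \<in> X; y \<in> X; 0 \<le> t\<rbrakk> \<Longrightarrow> M x y t \<in> \<I>"
    and M_zero: "\<lbrakk>x \<in> X; y \<in> X\<rbrakk> \<Longrightarrow> M x y 0 = 0"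
    and M_eq_one_iff: "\<lbrakk>x \<in> X; y \<in> X\<rbrakk> \<Longrightarrow> (\<forall>t>0. M x y t = 1) \<longleftrightarrow> x = y"
    and M_commute: "\<lbrakk>x \<in> X; y \<in> X; 0 \<le> t\<rbrakk> \<Longrightarrow> M x y t = M y x t"
    and M_triangle: "\<lbrakk>x \<in> X; y \<in> X; z \<in> X; 0 \<le> t; 0 \<le> s\<rbrakk>
      \<Longrightarrow> star (M x y t) (M y z s) \<le> M x z (t + s)"
    and M_left_continuous: "\<lbrakk>x \<in> X; y \<in> X; 0 < t\<rbrakk> \<Longrightarrow> continuous (at_left t) (M x y)"

definition Psi :: "(real \<Rightarrow> real) set"
  where "Psi = {\<psi>. \<psi> \<in> \<I> \<rightarrow> \<I> \<and> continuous_on \<I> \<psi> \<and> mono_on \<I> \<psi> \<and> (\<forall>t\<in>{0<..<1}. t < \<psi> t)}"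

text \<open>
  \<open>fuzzy_psi_contraction_with X M star T \<psi>\<close>: \<open>T\<close> is a Mihet fuzzy contraction
  with associated function \<open>\<psi>\<close>.  The t-norm is required to be continuous here, although
  it is not in a general fuzzy metric space.
\<close>

definition fuzzy_psi_contraction_with ::
  "'a set \<Rightarrow> ('a \<Rightarrow> 'a \<Rightarrow> real \<Rightarrow> real) \<Rightarrow> (real \<Rightarrow> real \<Rightarrow> real) \<Rightarrow> ('a \<Rightarrow> 'a) \<Rightarrow> (real \<Rightarrow> real) \<Rightarrow> bool"
  where "fuzzy_psi_contraction_with X M star T \<psi> \<longleftrightarrow>
    km_fuzzy_metric_space X M star \<and>
    continuous_on (\<I> \<times> \<I>) (\<lambda>(a, b). star a b) \<and>
    T \<in> X \<rightarrow> X \<and> \<psi> \<in> Psi \<and>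
    (\<forall>x\<in>X. \<forall>y\<in>X. \<forall>t>0. 0 < M x y t \<longrightarrow> \<psi> (M x y t) \<le> M (T x) (T y) t)"

definition strict_rel :: "('a \<times> 'a) set \<Rightarrow> 'a \<Rightarrow> 'a \<Rightarrow> bool"
  where "strict_rel S x y \<longleftrightarrow> (x, y) \<in> S \<and> x \<noteq> y"

definition strictly_increasing_seq :: "('a \<times> 'a) set \<Rightarrow> (nat \<Rightarrow> 'a) \<Rightarrow> bool"
  where "strictly_increasing_seq S x \<longleftrightarrow> (\<forall>n. strict_rel S (x n) (x (Suc n)))"

definition picard_seq :: "'a set \<Rightarrow> ('a \<Rightarrow> 'a) \<Rightarrow> (nat \<Rightarrow> 'a) \<Rightarrow> bool"
  where "picard_seq X T x \<longleftrightarrow> (\<forall>n. x n \<in> X) \<and> (\<forall>n. x (Suc n) = T (x n))"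

definition value_pairs ::
  "'a set \<Rightarrow> ('a \<Rightarrow> 'a \<Rightarrow> real \<Rightarrow> real) \<Rightarrow> ('a \<times> 'a) set \<Rightarrow> ('a \<Rightarrow> 'a) \<Rightarrow> (real \<times> real) set"
  where "value_pairs X M S T = {(M (T x) (T y) t, M x y t) | x y t.
    x \<in> X \<and> y \<in> X \<and> strict_rel S x y \<and> strict_rel S (T x) (T y) \<and> 0 \<le> t}"

text \<open>
  \<open>(T, S\<^sup>*, M)\<close>-sequences of pairs \<open>(\<phi> n, \<eta> n)\<close>; the second components are called
  \<open>\<eta>\<close> to keep them apart from the function \<open>\<psi>\<close> of a contraction.
\<close>

definition TSM_sequence ::
  "'a set \<Rightarrow> ('a \<Rightarrow> 'a \<Rightarrow> real \<Rightarrow> real) \<Rightarrow> ('a \<times> 'a) set \<Rightarrow> ('a \<Rightarrow> 'a)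
    \<Rightarrow> (nat \<Rightarrow> real \<Rightarrow> real) \<Rightarrow> (nat \<Rightarrow> real \<Rightarrow> real) \<Rightarrow> bool"
  where "TSM_sequence X M S T \<phi> \<eta> \<longleftrightarrow>
    (\<forall>n. \<phi> n \<in> {0..} \<rightarrow> \<I> \<and> \<eta> n \<in> {0..} \<rightarrow> \<I>) \<and>
    (\<exists>x y. \<forall>n. x n \<in> X \<and> y n \<in> X \<and> strict_rel S (x n) (y n) \<and> strict_rel S (T (x n)) (T (y n)) \<and>
      (\<forall>t>0. \<phi> n t = M (T (x n)) (T (y n)) t \<and> \<eta> n t = M (x n) (y n) t))"

text \<open>
  A function \<open>\<theta> : B \<rightarrow> \<real>\<close> with \<open>B \<subseteq> \<real>\<^sup>2\<close> is represented by the set \<open>B\<close> together with a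
  curried total function.  Condition F1 ensures that the conditions F2, F2', F3, F4 and F5
  below evaluate \<open>\<theta>\<close> only at points of \<open>B\<close>.
\<close>

definition F1 ::
  "'a set \<Rightarrow> ('a \<Rightarrow> 'a \<Rightarrow> real \<Rightarrow> real) \<Rightarrow> ('a \<times> 'a) set \<Rightarrow> (real \<times> real) set \<Rightarrow> ('a \<Rightarrow> 'a) \<Rightarrow> bool"
  where "F1 X M S B T \<longleftrightarrow> B \<noteq> {} \<and> value_pairs X M S T \<subseteq> B"

definition F2 ::
  "'a set \<Rightarrow> ('a \<Rightarrow> 'a \<Rightarrow> real \<Rightarrow> real) \<Rightarrow> ('a \<times> 'a) set \<Rightarrow> (real \<Rightarrow> real \<Rightarrow> real) \<Rightarrow> ('a \<Rightarrow> 'a) \<Rightarrow> bool"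
  where "F2 X M S \<theta> T \<longleftrightarrow>
    (\<forall>x. picard_seq X T x \<and> strictly_increasing_seq S x \<and>
      (\<forall>n. \<forall>t>0. 0 < M (x n) (x (n + 1)) t \<and>
        0 \<le> \<theta> (M (x (n + 1)) (x (n + 2)) t) (M (x n) (x (n + 1)) t))
      \<longrightarrow> (\<forall>t>0. (\<lambda>n. M (x n) (x (n + 1)) t) \<longlonglongrightarrow> 1))"

definition F2' ::
  "'a set \<Rightarrow> ('a \<Rightarrow> 'a \<Rightarrow> real \<Rightarrow> real) \<Rightarrow> ('a \<times> 'a) set \<Rightarrow> (real \<Rightarrow> real \<Rightarrow> real) \<Rightarrow> ('a \<Rightarrow> 'a) \<Rightarrow> bool"
  where "F2' X M S \<theta> T \<longleftrightarrow>
    (\<forall>x y. picard_seq X T x \<and> picard_seq X T y \<and> (\<forall>n. strict_rel S (x n) (y n)) \<and>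
      (\<forall>n. \<forall>t>0. 0 < M (x n) (y n) t \<and>
        0 \<le> \<theta> (M (x (n + 1)) (y (n + 1)) t) (M (x n) (y n) t))
      \<longrightarrow> (\<forall>t>0. (\<lambda>n. M (x n) (y n) t) \<longlonglongrightarrow> 1))"

definition F3 ::
  "'a set \<Rightarrow> ('a \<Rightarrow> 'a \<Rightarrow> real \<Rightarrow> real) \<Rightarrow> ('a \<times> 'a) set \<Rightarrow> (real \<Rightarrow> real \<Rightarrow> real) \<Rightarrow> ('a \<Rightarrow> 'a) \<Rightarrow> bool"
  where "F3 X M S \<theta> T \<longleftrightarrow>
    (\<forall>\<phi> \<eta> t\<^sub>0 L. TSM_sequence X M S T \<phi> \<eta> \<and> 0 < t\<^sub>0 \<and> L \<in> \<I> \<and>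
      (\<lambda>n. \<phi> n t\<^sub>0) \<longlonglongrightarrow> L \<and> (\<lambda>n. \<eta> n t\<^sub>0) \<longlonglongrightarrow> L \<and>
      (\<forall>n. \<phi> n t\<^sub>0 < L \<and> 0 \<le> \<theta> (\<phi> n t\<^sub>0) (\<eta> n t\<^sub>0))
      \<longrightarrow> L = 1)"

definition F4 ::
  "'a set \<Rightarrow> ('a \<Rightarrow> 'a \<Rightarrow> real \<Rightarrow> real) \<Rightarrow> ('a \<times> 'a) set \<Rightarrow> (real \<Rightarrow> real \<Rightarrow> real) \<Rightarrow> ('a \<Rightarrow> 'a) \<Rightarrow> bool"
  where "F4 X M S \<theta> T \<longleftrightarrow>
    (\<forall>x\<in>X. \<forall>y\<in>X. \<forall>t\<^sub>0>0. strict_rel S x y \<and> strict_rel S (T x) (T y) \<and> 0 < M x y t\<^sub>0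
      \<longrightarrow> 0 \<le> \<theta> (M (T x) (T y) t\<^sub>0) (M x y t\<^sub>0))"

definition F5 ::
  "'a set \<Rightarrow> ('a \<Rightarrow> 'a \<Rightarrow> real \<Rightarrow> real) \<Rightarrow> ('a \<times> 'a) set \<Rightarrow> (real \<Rightarrow> real \<Rightarrow> real) \<Rightarrow> ('a \<Rightarrow> 'a) \<Rightarrow> bool"
  where "F5 X M S \<theta> T \<longleftrightarrow>
    (\<forall>\<phi> \<eta>. TSM_sequence X M S T \<phi> \<eta> \<and>
      (\<forall>n. \<forall>t>0. 0 < \<phi> n t \<and> 0 < \<eta> n t \<and> 0 \<le> \<theta> (\<phi> n t) (\<eta> n t)) \<and>
      (\<forall>t>0. (\<lambda>n. \<eta> n t) \<longlonglongrightarrow> 1)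
      \<longrightarrow> (\<forall>t>0. (\<lambda>n. \<phi> n t) \<longlonglongrightarrow> 1))"

definition type2_fuzzy_ample_spectrum_contraction ::
  "'a set \<Rightarrow> ('a \<Rightarrow> 'a \<Rightarrow> real \<Rightarrow> real) \<Rightarrow> ('a \<times> 'a) set \<Rightarrow> (real \<times> real) set
    \<Rightarrow> (real \<Rightarrow> real \<Rightarrow> real) \<Rightarrow> ('a \<Rightarrow> 'a) \<Rightarrow> bool"
  where "type2_fuzzy_ample_spectrum_contraction X M S B \<theta> T \<longleftrightarrow>
    T \<in> X \<rightarrow> X \<and> S \<subseteq> X \<times> X \<and>
    F1 X M S B T \<and> F2 X M S \<theta> T \<and> F3 X M S \<theta> T \<and> F4 X M S \<theta> T"

definition theta_psi :: "(real \<Rightarrow> real) \<Rightarrow> real \<Rightarrow> real \<Rightarrow> real"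
  where "theta_psi \<psi> t s = t - \<psi> s"

end

theory Submission
  imports Defs
begin

text \<open>
  Everything rests on \<open>t \<le> \<psi> t\<close> on \<open>[0, 1]\<close>, strictly inside, and on the continuity of
  \<open>\<psi>\<close>: a limit \<open>L > 0\<close> of values related by \<open>\<psi>\<close> satisfies \<open>\<psi> L \<le> L\<close>, so \<open>L = 1\<close>.
  An orbit with \<open>\<psi> (a n) \<le> a (n + 1)\<close> is nondecreasing, hence convergent, hence
  tends to \<open>1\<close> once it starts at a positive value.
\<close>

text \<open>\<open>Psi\<close> gives the strict inequality only on the open interval. At 0 the range
  of \<open>\<psi>\<close> suffices; at 1 monotonicity yields
  \<open>w < \<psi> w \<le> \<psi> 1\<close> for every \<open>w\<close> in (0, 1), and such
  \<open>w\<close> come arbitrarily close to 1.\<close>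

lemma Psi_ge:
  assumes "\<psi> \<in> Psi" "t \<in> \<I>"
  shows "t \<le> \<psi> t"
proof -
  have range: "\<psi> \<in> \<I> \<rightarrow> \<I>" and mono: "mono_on \<I> \<psi>"
    and gt: "\<And>t. 0 < t \<Longrightarrow> t < 1 \<Longrightarrow> t < \<psi> t"
    using assms(1) by (auto simp: Psi_def)
  consider "t = 0" | "0 < t" "t < 1" | "t = 1"
    using assms(2) by fastforce
  then show ?thesis
  proof cases
    case 1
    then show ?thesis using range by auto
  next
    case 2
    then show ?thesis using gt[of t] by simp
  next
    case 3
    have "1 \<le> \<psi> 1"
    proof (rule dense_le_bounded[of 0])
      fix w :: real assume w: "0 < w" "w < 1"
      then have "w < \<psi> w" by (rule gt)
      also have "\<psi> w \<le> \<psi> 1" using w by (intro mono_onD[OF mono]) auto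
      finally show "w \<le> \<psi> 1" by simp
    qed simp
    then show ?thesis using 3 by simp
  qed
qed

text \<open>Two sequences make this fit both uses: for an orbit \<open>b\<close> is the shift of
  \<open>a\<close>, and for F3 \<open>b\<close> collects the values at the image points. Positivity
  of \<open>L\<close> excludes the possible fixed point 0 of \<open>\<psi>\<close>, as for the
  square root.\<close>

lemma Psi_limit_eq_1:
  assumes psi: "\<psi> \<in> Psi"
    and a: "a \<longlonglongrightarrow> L" "\<And>n. a n \<in> \<I>"
    and b: "b \<longlonglongrightarrow> L"
    and le: "\<And>n. \<psi> (a n) \<le> b n"
    and pos: "0 < L"
  shows "L = 1"
proof -
  have L: "L \<in> \<I>" using closed_sequentially[OF _ a(2,1)] by simp
  have cont: "continuous_on \<I> \<psi>" and gt: "\<And>t. 0 < t \<Longrightarrow> t < 1 \<Longrightarrow> t < \<psi> t"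
    using psi by (auto simp: Psi_def)
  have "(\<lambda>n. \<psi> (a n)) \<longlonglongrightarrow> \<psi> L"
    by (rule continuous_on_tendsto_compose[OF cont a(1) L]) (simp add: a(2)[simplified])
  then have "\<psi> L \<le> L" using b by (rule LIMSEQ_le) (use le in auto)
  then show ?thesis using gt[of L] L pos by fastforce
qed

lemma Psi_orbit_tendsto_1:
  assumes psi: "\<psi> \<in> Psi"
    and a: "\<And>n. a n \<in> \<I>"
    and step: "\<And>n. \<psi> (a n) \<le> a (Suc n)"
    and pos: "0 < a 0"
  shows "a \<longlonglongrightarrow> 1"
proof -
  have inc: "incseq a"
    using Psi_ge[OF psi a] step order_trans by (blast intro: incseq_SucI)
  obtain L where L: "a \<longlonglongrightarrow> L" "\<And>n. a n \<le> L"
    using incseq_convergent[OF inc, of 1] a by auto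
  have "L = 1"
    \<comment> \<open>Here \<open>b n\<close> is \<open>a (Suc n)\<close>, and \<open>L\<close> is
      positive because it bounds the increasing sequence: \<open>0 < a 0 \<le> L\<close>.\<close>
    using psi L(1) a LIMSEQ_Suc[OF L(1)] step
    by (rule Psi_limit_eq_1) (use pos L(2)[of 0] in simp)
  then show ?thesis using L(1) by simp
qed

text \<open>For each fixed \<open>t\<close>, nonnegativity of \<open>theta_psi\<close> says exactly
  that \<open>M (x n) (y n) t\<close> is an orbit in the sense of
  \<open>Psi_orbit_tendsto_1\<close>.\<close>

lemma (in km_fuzzy_metric_space) F2'_theta_psi:
  assumes "\<psi> \<in> Psi"
  shows "F2' X M S (theta_psi \<psi>) T"
  unfolding F2'_def
proof (intro allI impI, elim conjE)
  fix x y :: "nat \<Rightarrow> 'a" and t :: real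
  assume "picard_seq X T x" "picard_seq X T y" and "0 < t"
    and H: "\<forall>n. \<forall>t>0. 0 < M (x n) (y n) t \<and>
      0 \<le> theta_psi \<psi> (M (x (n + 1)) (y (n + 1)) t) (M (x n) (y n) t)"
  then show "(\<lambda>n. M (x n) (y n) t) \<longlonglongrightarrow> 1"
    using M_closed by (intro Psi_orbit_tendsto_1[OF assms]) (auto simp: picard_seq_def theta_psi_def simp del: atLeastAtMost_iff)
qed

text \<open>The shift of a Picard sequence is again Picard, so F2' applies to \<open>x\<close>
  paired with its own shift; strict increase of \<open>x\<close> is then the required relation
  between the two.\<close>

lemma F2'_imp_F2:
  assumes "F2' X M S \<theta> T"
  shows "F2 X M S \<theta> T"
  unfolding F2_def
proof (intro allI impI, elim conjE)
  fix x :: "nat \<Rightarrow> 'a" and t :: real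
  assume "picard_seq X T x" "strictly_increasing_seq S x" "0 < t"
    and "\<forall>n. \<forall>t>0. 0 < M (x n) (x (n + 1)) t \<and>
      0 \<le> \<theta> (M (x (n + 1)) (x (n + 2)) t) (M (x n) (x (n + 1)) t)"
  then show "(\<lambda>n. M (x n) (x (n + 1)) t) \<longlonglongrightarrow> 1"
    using assms[unfolded F2'_def, rule_format, of x "\<lambda>n. x (n + 1)" t]
    by (simp add: picard_seq_def strictly_increasing_seq_def) metis
qed

lemma F3_theta_psi:
  assumes "\<psi> \<in> Psi"
  shows "F3 X M S (theta_psi \<psi>) T"
  unfolding F3_def
proof (intro allI impI, elim conjE)
  fix \<phi> \<eta> :: "nat \<Rightarrow> real \<Rightarrow> real" and t L :: real
  assume seq: "TSM_sequence X M S T \<phi> \<eta>" and t: "0 < t"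
    and lim: "(\<lambda>n. \<phi> n t) \<longlonglongrightarrow> L" "(\<lambda>n. \<eta> n t) \<longlonglongrightarrow> L"
    and H: "\<forall>n. \<phi> n t < L \<and> 0 \<le> theta_psi \<psi> (\<phi> n t) (\<eta> n t)"
  have range: "\<phi> n t \<in> \<I>" "\<eta> n t \<in> \<I>" for n
    using seq t by (auto simp: TSM_sequence_def Pi_iff simp del: atLeastAtMost_iff)
  \<comment> \<open>The strict bound \<open>\<phi> n t < L\<close> enters here: with
    \<open>0 \<le> \<phi> 0 t\<close> it rules out \<open>L = 0\<close>.\<close>
  have "0 < L" using range(1)[of 0] H le_less_trans by (metis atLeastAtMost_iff)
  moreover have "\<psi> (\<eta> n t) \<le> \<phi> n t" for n
    using H by (simp add: theta_psi_def)
  ultimately show "L = 1"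
    using Psi_limit_eq_1[OF assms lim(2) range(2) lim(1)] by blast
qed

text \<open>A squeeze: \<open>\<eta> n t \<le> \<psi> (\<eta> n t) \<le> \<phi> n t \<le>
  1\<close>.\<close>

lemma F5_theta_psi:
  assumes "\<psi> \<in> Psi"
  shows "F5 X M S (theta_psi \<psi>) T"
  unfolding F5_def
proof (intro allI impI, elim conjE)
  fix \<phi> \<eta> :: "nat \<Rightarrow> real \<Rightarrow> real" and t :: real
  assume seq: "TSM_sequence X M S T \<phi> \<eta>" and t: "0 < t"
    and H: "\<forall>n. \<forall>t>0. 0 < \<phi> n t \<and> 0 < \<eta> n t \<and> 0 \<le> theta_psi \<psi> (\<phi> n t) (\<eta> n t)"
    and lim: "\<forall>t>0. (\<lambda>n. \<eta> n t) \<longlonglongrightarrow> 1"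
  have range: "\<phi> n t \<in> \<I>" "\<eta> n t \<in> \<I>" for n
    using seq t by (auto simp: TSM_sequence_def Pi_iff simp del: atLeastAtMost_iff)
  have "\<eta> n t \<le> \<phi> n t" for n
    using Psi_ge[OF assms range(2)[of n]] H[rule_format, OF t, of n] by (simp add: theta_psi_def)
  then show "(\<lambda>n. \<phi> n t) \<longlonglongrightarrow> 1"
    using range(1) lim t
    by (intro tendsto_sandwich[of "\<lambda>n. \<eta> n t" "\<lambda>n. \<phi> n t" sequentially "\<lambda>_. 1"]) auto
qed

theorem theorem41:
  fixes X :: "'a set" and M :: "'a \<Rightarrow> 'a \<Rightarrow> real \<Rightarrow> real" and star :: "real \<Rightarrow> real \<Rightarrow> real"
    and T :: "'a \<Rightarrow> 'a" and \<psi> :: "real \<Rightarrow> real"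
  assumes "km_fuzzy_metric_space X M star"
    and "fuzzy_psi_contraction_with X M star T \<psi>"
  shows "type2_fuzzy_ample_spectrum_contraction X M (X \<times> X) (\<I> \<times> \<I>) (theta_psi \<psi>) T \<and>
    F2' X M (X \<times> X) (theta_psi \<psi>) T \<and>
    F5 X M (X \<times> X) (theta_psi \<psi>) T \<and>
    (\<forall>t\<in>\<I>. \<forall>s\<in>\<I>. 0 \<le> theta_psi \<psi> t s \<and> 0 < s \<longrightarrow> 0 < t) \<and>
    (\<forall>t\<in>\<I>. \<forall>s\<in>\<I>. theta_psi \<psi> t s \<le> t - s)"
proof -
  interpret km_fuzzy_metric_space X M star by fact
  have T: "T \<in> X \<rightarrow> X" and psi: "\<psi> \<in> Psi"
    and contr: "\<And>x y t. \<lbrakk>x \<in> X; y \<in> X; 0 < t; 0 < M x y t\<rbrakk> \<Longrightarrow> \<psi> (M x y t) \<le> M (T x) (T y) t"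
    using assms(2) by (auto simp: fuzzy_psi_contraction_with_def)
  note F2' = F2'_theta_psi[OF psi, of "X \<times> X" T]
  have "F1 X M (X \<times> X) (\<I> \<times> \<I>) T"
    using M_closed T
    by (auto simp: F1_def value_pairs_def Pi_iff simp del: atLeastAtMost_iff)
  \<comment> \<open>For \<open>theta_psi\<close> this is the contraction inequality
    rearranged.\<close>
  moreover have "F4 X M (X \<times> X) (theta_psi \<psi>) T"
    using contr by (simp add: F4_def theta_psi_def)
  ultimately have "type2_fuzzy_ample_spectrum_contraction X M (X \<times> X) (\<I> \<times> \<I>) (theta_psi \<psi>) T"
    using T F2'_imp_F2[OF F2'] F3_theta_psi[OF psi]
    by (simp add: type2_fuzzy_ample_spectrum_contraction_def)
  then show ?thesis
    \<comment> \<open>Both final claims come from \<open>s \<le> \<psi> s\<close>: it bounds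
      \<open>t - \<psi> s\<close> by \<open>t - s\<close>, and gives
      \<open>0 < s \<le> \<psi> s \<le> t\<close> when \<open>theta_psi\<close> is
      nonnegative.\<close>
    using F2' F5_theta_psi[OF psi] Psi_ge[OF psi] by (fastforce simp: theta_psi_def)
qed

end
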